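(* Problems (L) and (F) satisfy the following relations on their local minimizers and stationary points. (i) $\mathcal{L}_{(L)}\subseteq\{(XY^{\mathbb{T}},S):(X,Y,S)\in\mathcal{L}_{(F)}\}$ and $\mathcal{S}_{(L)}\subseteq\{(XY^{\mathbb{T}},S):(X,Y,S)\in\mathcal{S}_{(F)}\}$. (ii) When $\lambda>0$, $\mathcal{S}_{(L)}=\{(XY^{\mathbb{T}},S):(X,Y,S)\in\mathcal{S}_{(F)}\}$.
   Context: Let $m,n,d$ be positive integers, $\lambda,\beta\ge 0$, and let $f:\mathbb{R}^{m\times n}\times\mathbb{R}^{m\times n}\to[0,+\infty)$, $(Z,S)\mapsto f(Z,S)$, be locally Lipschitz continuous. $\|S\|_0$ is the number of nonzero entries of $S$; $\mathrm{nnzc}(X)$ is the number of nonzero columns of $X$. Let $\mathcal{B}^S:=\{S\in\mathbb{R}^{m\times n}:\kappa^1_{ij}\le S_{ij}\le\kappa^2_{ij}\ \forall i,j\}$ with given $\kappa^1_{ij}\in[-\infty,0]$, $\kappa^2_{ij}\in[0,+\infty]$. Problem (L): minimize $F_0(Z,S):=f(Z,S)+2\lambda\,\mathrm{rank}(Z)+\beta\|S\|_0$ over $(Z,S)\in\mathbb{R}^{m\times n}\times\mathcal{B}^S$ with $\mathrm{rank}(Z)\le d$. Problem (F): minimize $F(X,Y,S):=f(XY^{\mathbb{T}},S)+\lambda(\mathrm{nnzc}(X)+\mathrm{nnzc}(Y))+\beta\|S\|_0$ over $(X,Y,S)\in\mathbb{R}^{m\times d}\times\mathbb{R}^{n\times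 d}\times\mathcal{B}^S$. $\mathcal{L}_{(P)}$ denotes the set of local minimizers of a problem $(P)$. $\partial$ is the limiting (Mordukhovich) subdifferential and $N_\Omega(\cdot)$ the limiting normal cone, in the sense of Rockafellar–Wets. Index sets: for $U\in\mathbb{R}^{p\times d}$, $\mathbb{I}_U:=\{i\in[d]:U_i\ne\bm 0\}$ ($U_i$ the $i$-th column) if $\lambda>0$, and $\mathbb{I}_U:=[d]$ if $\lambda=0$. For $S\in\mathbb{R}^{m\times n}$, $\mathbb{J}_S:=\{(i,j):S_{ij}\neq0\}$ if $\beta>0$, and $\mathbb{J}_S:=[m]\times[n]$ if $\beta=0$. Restricted sets: for an index set $\mathbb{J}\subseteq[m]\times[n]$, $\underline{\mathcal{B}}^S_{\mathbb{J}}$ is the set of matrices obtained from elements of $\mathcal{B}^S$ by setting to zero all entries outside $\mathbb{J}$; for $\mathbb{I}\subseteq[d]$, $\underline{\mathbb{R}}^{p\times d}_{\mathbb{I}}$ is the set of matrices in $\mathbb{R}^{p\times d}$ whose columns outside $\mathbb{I}$ are zero. Stationary points of (L): $\mathcal{S}_{(L)}$ is the set of $(\bar Z,\bar S)\in\mathbb{R}^{m\times n}\times\mathcal{B}^S$ with $\mathrm{rank}(\bar Z)\le d$ for which there exists $(H_Z,H_S)\in\partial f(\bar Z,\bar S)$ such that $-H_Z\in N_{\mathcal{M}_{\lambda,\bar Z}}(\bar Z)$ and $-H_S\in N_{\underline{\mathcal{B}}^S_{\mathbb{J}_{\bar S}}}(\bar S)$, where $\mathcal{M}_{\lambda,\bar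 Z}:=\{Z\in\mathbb{R}^{m\times n}:\mathrm{rank}(Z)\le d,\ \lambda\,\mathrm{rank}(Z)=\lambda\,\mathrm{rank}(\bar Z)\}$. Stationary points of (F): $\mathcal{S}_{(F)}$ is the set of $(\bar X,\bar Y,\bar S)\in\mathbb{R}^{m\times d}\times\mathbb{R}^{n\times d}\times\mathcal{B}^S$ for which there exists $(H_Z,H_S)\in\partial f(\bar X\bar Y^{\mathbb{T}},\bar S)$ such that $\bm 0\in H_Z\bar Y+N_{\underline{\mathbb{R}}^{m\times d}_{\mathbb{I}_{\bar X}}}(\bar X)$, $\bm 0\in H_Z^{\mathbb{T}}\bar X+N_{\underline{\mathbb{R}}^{n\times d}_{\mathbb{I}_{\bar Y}}}(\bar Y)$ and $\bm 0\in H_S+N_{\underline{\mathcal{B}}^S_{\mathbb{J}_{\bar S}}}(\bar S)$. *)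

theory Defs
  imports "HOL-Analysis.Analysis"
begin

text \<open>
  An $m \times n$ real matrix is an element of \<open>real^'n^'m\<close>. The inner product and norm
  of this type, and of products of such types, are the Frobenius (Euclidean) ones.
\<close>

definition locally_lipschitz :: "('a::metric_space \<Rightarrow> 'b::metric_space) \<Rightarrow> bool" where
  "locally_lipschitz f \<longleftrightarrow> (\<forall>x. \<exists>e>0. \<exists>L. L-lipschitz_on (ball x e) f)"

definition local_minimizers :: "('a::metric_space \<Rightarrow> real) \<Rightarrow> 'a set \<Rightarrow> 'a set" where
  "local_minimizers F C = {x \<in> C. \<exists>e>0. \<forall>y \<in> C \<inter> ball x e. F x \<le> F y}"

text \<open>
  Subdifferentials and normal cones follow Rockafellar--Wets, Variational Analysis,
  Definitions 8.3 and 6.3, with the little-o terms there written out as lower and upper limits.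
\<close>

definition regular_subdifferential :: "('a::euclidean_space \<Rightarrow> real) \<Rightarrow> 'a \<Rightarrow> 'a set" where
  "regular_subdifferential f x =
     {v. 0 \<le> Liminf (at x) (\<lambda>y. ereal ((f y - f x - v \<bullet> (y - x)) / norm (y - x)))}"

definition limiting_subdifferential :: "('a::euclidean_space \<Rightarrow> real) \<Rightarrow> 'a \<Rightarrow> 'a set" where
  "limiting_subdifferential f x =
     {v. \<exists>xs vs. xs \<longlonglongrightarrow> x \<and> (\<lambda>k. f (xs k)) \<longlonglongrightarrow> f x \<and>
           (\<forall>k. vs k \<in> regular_subdifferential f (xs k)) \<and> vs \<longlonglongrightarrow> v}"

text \<open>
  At an isolated point of \<open>C\<close> the filter below is trivial, so the upper limit is
  $-\infty$ and every vector is a regular normal. Both cones are empty at points outside \<open>C\<close>.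
\<close>

definition regular_normal_cone :: "'a::euclidean_space set \<Rightarrow> 'a \<Rightarrow> 'a set" where
  "regular_normal_cone C x =
     {v. x \<in> C \<and> Limsup (at x within C) (\<lambda>y. ereal (v \<bullet> (y - x) / norm (y - x))) \<le> 0}"

definition limiting_normal_cone :: "'a::euclidean_space set \<Rightarrow> 'a \<Rightarrow> 'a set" where
  "limiting_normal_cone C x =
     {v. x \<in> C \<and> (\<exists>xs vs. xs \<longlonglongrightarrow> x \<and> (\<forall>k. xs k \<in> C) \<and>
           (\<forall>k. vs k \<in> regular_normal_cone C (xs k)) \<and> vs \<longlonglongrightarrow> v)}"

definition l0norm :: "real^'n^'m \<Rightarrow> nat" where
  "l0norm S = card {(i, j). S $ i $ j \<noteq> 0}"

definition nnzc :: "real^'d^'p \<Rightarrow> nat" where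
  "nnzc U = card {i. column i U \<noteq> 0}"

definition entry_box :: "ereal^'n^'m \<Rightarrow> ereal^'n^'m \<Rightarrow> (real^'n^'m) set" where
  "entry_box \<kappa>1 \<kappa>2 =
     {S. \<forall>i j. \<kappa>1 $ i $ j \<le> ereal (S $ i $ j) \<and> ereal (S $ i $ j) \<le> \<kappa>2 $ i $ j}"

definition col_index :: "real \<Rightarrow> real^'d^'p \<Rightarrow> 'd set" where
  "col_index lam U = (if lam > 0 then {i. column i U \<noteq> 0} else UNIV)"

definition entry_index :: "real \<Rightarrow> real^'n^'m \<Rightarrow> ('m \<times> 'n) set" where
  "entry_index beta S = (if beta > 0 then {(i, j). S $ i $ j \<noteq> 0} else UNIV)"

definition restrict_entries :: "('m \<times> 'n) set \<Rightarrow> real^'n^'m \<Rightarrow> real^'n^'m" where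
  "restrict_entries J S = (\<chi> i j. if (i, j) \<in> J then S $ i $ j else 0)"

definition restricted_box ::
    "ereal^'n^'m \<Rightarrow> ereal^'n^'m \<Rightarrow> ('m \<times> 'n) set \<Rightarrow> (real^'n^'m) set" where
  "restricted_box \<kappa>1 \<kappa>2 J = restrict_entries J ` entry_box \<kappa>1 \<kappa>2"

definition restricted_cols :: "'d set \<Rightarrow> (real^'d^'p) set" where
  "restricted_cols I = {U. \<forall>i. i \<notin> I \<longrightarrow> column i U = 0}"

definition rank_set :: "nat \<Rightarrow> real \<Rightarrow> real^'n^'m \<Rightarrow> (real^'n^'m) set" where
  "rank_set d lam Zb = {Z. rank Z \<le> d \<and> lam * real (rank Z) = lam * real (rank Zb)}"

definition objective_L ::
    "((real^'n^'m) \<times> (real^'n^'m) \<Rightarrow> real) \<Rightarrow> real \<Rightarrow> real \<Rightarrow>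
     (real^'n^'m) \<times> (real^'n^'m) \<Rightarrow> real" where
  "objective_L f lam beta =
     (\<lambda>(Z, S). f (Z, S) + 2 * lam * real (rank Z) + beta * real (l0norm S))"

definition feasible_L ::
    "nat \<Rightarrow> ereal^'n^'m \<Rightarrow> ereal^'n^'m \<Rightarrow> ((real^'n^'m) \<times> (real^'n^'m)) set" where
  "feasible_L d \<kappa>1 \<kappa>2 = {(Z, S). rank Z \<le> d \<and> S \<in> entry_box \<kappa>1 \<kappa>2}"

definition objective_F ::
    "((real^'n^'m) \<times> (real^'n^'m) \<Rightarrow> real) \<Rightarrow> real \<Rightarrow> real \<Rightarrow>
     (real^'d^'m) \<times> (real^'d^'n) \<times> (real^'n^'m) \<Rightarrow> real" where
  "objective_F f lam beta =
     (\<lambda>(X, Y, S). f (X ** transpose Y, S)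
        + lam * (real (nnzc X) + real (nnzc Y)) + beta * real (l0norm S))"

definition feasible_F ::
    "ereal^'n^'m \<Rightarrow> ereal^'n^'m \<Rightarrow> ((real^'d^'m) \<times> (real^'d^'n) \<times> (real^'n^'m)) set" where
  "feasible_F \<kappa>1 \<kappa>2 = {(X, Y, S). S \<in> entry_box \<kappa>1 \<kappa>2}"

definition stationary_L ::
    "((real^'n^'m) \<times> (real^'n^'m) \<Rightarrow> real) \<Rightarrow> real \<Rightarrow> real \<Rightarrow> nat \<Rightarrow>
     ereal^'n^'m \<Rightarrow> ereal^'n^'m \<Rightarrow> ((real^'n^'m) \<times> (real^'n^'m)) set" where
  "stationary_L f lam beta d \<kappa>1 \<kappa>2 =
     {(Z, S) \<in> feasible_L d \<kappa>1 \<kappa>2.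
        \<exists>HZ HS. (HZ, HS) \<in> limiting_subdifferential f (Z, S) \<and>
          - HZ \<in> limiting_normal_cone (rank_set d lam Z) Z \<and>
          - HS \<in> limiting_normal_cone (restricted_box \<kappa>1 \<kappa>2 (entry_index beta S)) S}"

definition stationary_F ::
    "((real^'n^'m) \<times> (real^'n^'m) \<Rightarrow> real) \<Rightarrow> real \<Rightarrow> real \<Rightarrow>
     ereal^'n^'m \<Rightarrow> ereal^'n^'m \<Rightarrow> ((real^'d^'m) \<times> (real^'d^'n) \<times> (real^'n^'m)) set" where
  "stationary_F f lam beta \<kappa>1 \<kappa>2 =
     {(X, Y, S) \<in> feasible_F \<kappa>1 \<kappa>2.
        \<exists>HZ HS. (HZ, HS) \<in> limiting_subdifferential f (X ** transpose Y, S) \<and>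
          0 \<in> (HZ ** Y) +o limiting_normal_cone (restricted_cols (col_index lam X)) X \<and>
          0 \<in> (transpose HZ ** X) +o limiting_normal_cone (restricted_cols (col_index lam Y)) Y \<and>
          0 \<in> HS +o limiting_normal_cone (restricted_box \<kappa>1 \<kappa>2 (entry_index beta S)) S}"

definition factor_image ::
    "((real^'d^'m) \<times> (real^'d^'n) \<times> (real^'n^'m)) set \<Rightarrow> ((real^'n^'m) \<times> (real^'n^'m)) set" where
  "factor_image A = {(X ** transpose Y, S) | X Y S. (X, Y, S) \<in> A}"

end

theory Submission
  imports Defs
begin

text \<open>
  Let the nonzero columns of \<open>X\<close> be an orthonormal basis of the range of \<open>Z\<close> and put
  \<open>Y = transpose Z ** X\<close>. Then \<open>X ** transpose Y = Z\<close> and \<open>X\<close>, \<open>Y\<close> have at most \<open>rank Z\<close> nonzero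
  columns, while every factorization has at least that many. So (F) dominates (L) composed with
  \<open>(X, Y) \<mapsto> X ** transpose Y\<close>, with equality at \<open>(X, Y)\<close>, and local minimality transfers by continuity.

  Normal vectors \<open>v\<close> of the rank sets at \<open>Z\<close> satisfy \<open>v ** transpose Z = 0\<close> and
  \<open>transpose Z ** v = 0\<close>, because the set contains \<open>(1 + tA) ** Z\<close> and \<open>Z ** (1 + tB)\<close> for small
  \<open>t\<close>; hence both products in the stationarity system of (F) vanish at the above factors.
  Conversely, stationarity for (F) yields these two equations, and on the set of matrices of
  fixed rank they imply that \<open>v \<bullet> (Z' - Z)\<close> is quadratically small in \<open>Z' - Z\<close>.
\<close>

subsection \<open>Matrix algebra\<close>

lemma bounded_bilinear_matrix_mult:
  "bounded_bilinear ((**) :: real^'n^'m \<Rightarrow> real^'k^'n \<Rightarrow> real^'k^'m)"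
  unfolding bilinear_conv_bounded_bilinear[symmetric] bilinear_def
  by (auto intro!: linearI simp: vec_eq_iff matrix_matrix_mult_def algebra_simps
      sum.distrib sum_distrib_left)

interpretation matrix_mult: bounded_bilinear "(**) :: real^'n^'m \<Rightarrow> real^'k^'n \<Rightarrow> real^'k^'m"
  by (rule bounded_bilinear_matrix_mult)

lemma tendsto_transpose [tendsto_intros]:
  fixes A :: "'a \<Rightarrow> real^'n^'m"
  shows "(A \<longlongrightarrow> B) F \<Longrightarrow> ((\<lambda>x. transpose (A x)) \<longlongrightarrow> transpose B) F"
  unfolding transpose_def by (intro tendsto_vec_lambda tendsto_vec_nth)

lemma transpose_zero: "transpose (0 :: real^'n^'m) = 0"
  by (simp add: transpose_def vec_eq_iff)

lemma column_matrix_mult: "column j (A ** B) = A *v column j B"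
  by (simp add: vec_eq_iff column_def matrix_matrix_mult_def matrix_vector_mult_def)

section \<open>Frobenius inner product: adjoints and submultiplicativity\<close>

lemma inner_matrix_mult_left:
  fixes A :: "real^'n^'m" and B :: "real^'k^'n"
  shows "(A ** B) \<bullet> C = B \<bullet> (transpose A ** C)"
proof -
  have "(A ** B) \<bullet> C = (\<Sum>i\<in>UNIV. \<Sum>j\<in>UNIV. \<Sum>l\<in>UNIV. A$i$l * B$l$j * C$i$j)"
    by (simp add: inner_vec_def matrix_matrix_mult_def sum_distrib_right)
  also have "\<dots> = (\<Sum>i\<in>UNIV. \<Sum>l\<in>UNIV. \<Sum>j\<in>UNIV. A$i$l * B$l$j * C$i$j)"
    by (rule sum.cong[OF refl], rule sum.swap)
  also have "\<dots> = (\<Sum>l\<in>UNIV. \<Sum>i\<in>UNIV. \<Sum>j\<in>UNIV. A$i$l * B$l$j * C$i$j)"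
    by (rule sum.swap)
  also have "\<dots> = (\<Sum>l\<in>UNIV. \<Sum>j\<in>UNIV. \<Sum>i\<in>UNIV. A$i$l * B$l$j * C$i$j)"
    by (rule sum.cong[OF refl], rule sum.swap)
  also have "\<dots> = B \<bullet> (transpose A ** C)"
    by (simp add: inner_vec_def matrix_matrix_mult_def transpose_def sum_distrib_left mult_ac)
  finally show ?thesis .
qed

lemma inner_transpose: "transpose A \<bullet> transpose B = A \<bullet> (B :: real^'n^'m)"
proof -
  have "transpose A \<bullet> transpose B = (\<Sum>j\<in>UNIV. \<Sum>i\<in>UNIV. A$i$j * B$i$j)"
    by (simp add: inner_vec_def transpose_def)
  also have "\<dots> = (\<Sum>i\<in>UNIV. \<Sum>j\<in>UNIV. A$i$j * B$i$j)"
    by (rule sum.swap)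
  finally show ?thesis
    by (simp add: inner_vec_def)
qed

lemma inner_matrix_mult_right:
  fixes A :: "real^'n^'m" and B :: "real^'k^'n"
  shows "(A ** B) \<bullet> C = A \<bullet> (C ** transpose B)"
proof -
  have "(A ** B) \<bullet> C = (transpose B ** transpose A) \<bullet> transpose C"
    by (metis inner_transpose matrix_transpose_mul)
  also have "\<dots> = transpose A \<bullet> (B ** transpose C)"
    by (simp add: inner_matrix_mult_left)
  also have "\<dots> = A \<bullet> (C ** transpose B)"
    by (metis inner_transpose matrix_transpose_mul transpose_transpose)
  finally show ?thesis .
qed

lemma norm_matrix_vector_mult_le:
  fixes A :: "real^'n^'m"
  shows "norm (A *v x) \<le> norm A * norm x"
proof (rule power2_le_imp_le)
  have "(norm (A *v x))\<^sup>2 = (\<Sum>i\<in>UNIV. (A$i \<bullet> x)\<^sup>2)"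
    by (simp only: dot_square_norm[symmetric])
      (simp add: inner_vec_def matrix_vector_mult_def power2_eq_square)
  also have "\<dots> \<le> (\<Sum>i\<in>UNIV. (A$i \<bullet> A$i) * (x \<bullet> x))"
    by (intro sum_mono Cauchy_Schwarz_ineq)
  also have "\<dots> = (A \<bullet> A) * (x \<bullet> x)"
    by (simp add: inner_vec_def[of A A] sum_distrib_right)
  also have "\<dots> = (norm A * norm x)\<^sup>2"
    by (simp add: dot_square_norm power_mult_distrib)
  finally show "(norm (A *v x))\<^sup>2 \<le> (norm A * norm x)\<^sup>2" .
qed simp

lemma inner_self_columns:
  fixes A :: "real^'n^'m"
  shows "A \<bullet> A = (\<Sum>j\<in>UNIV. (norm (column j A))\<^sup>2)"
proof -
  have "A \<bullet> A = transpose A \<bullet> transpose A"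
    by (simp add: inner_transpose)
  also have "\<dots> = (\<Sum>j\<in>UNIV. (norm (column j A))\<^sup>2)"
    by (simp only: dot_square_norm[symmetric])
      (simp add: inner_vec_def transpose_def column_def)
  finally show ?thesis .
qed

text \<open>The bound for vectors, itself Cauchy-Schwarz on each row, is applied to every column of
  \<open>B\<close>; squared column norms add up to the squared Frobenius norm.\<close>

lemma norm_matrix_mult_le:
  fixes A :: "real^'n^'m" and B :: "real^'k^'n"
  shows "norm (A ** B) \<le> norm A * norm B"
proof (rule power2_le_imp_le)
  have "(norm (A ** B))\<^sup>2 = (\<Sum>j\<in>UNIV. (norm (A *v column j B))\<^sup>2)"
    by (simp only: dot_square_norm[symmetric] inner_self_columns column_matrix_mult)
  also have "\<dots> \<le> (\<Sum>j\<in>UNIV. (norm A * norm (column j B))\<^sup>2)"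
    by (intro sum_mono power_mono norm_matrix_vector_mult_le) simp
  also have "\<dots> = (norm A * norm B)\<^sup>2"
    by (simp only: power_mult_distrib dot_square_norm[symmetric, of B] inner_self_columns
        sum_distrib_left)
  finally show "(norm (A ** B))\<^sup>2 \<le> (norm A * norm B)\<^sup>2" .
qed simp

text \<open>A nonzero kernel vector would equal minus its image under \<open>M\<close>, which is
  strictly shorter. For square matrices a trivial kernel suffices.\<close>

lemma invertible_mat_1_plus:
  fixes M :: "real^'n^'n"
  assumes "norm M < 1"
  shows "invertible (mat 1 + M)"
proof -
  have "x = 0" if "(mat 1 + M) *v x = 0" for x
  proof (rule ccontr)
    assume "x \<noteq> 0"
    have "x = - (M *v x)"
      using that by (simp add: matrix_vector_mult_add_rdistrib eq_neg_iff_add_eq_0)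
    then have "norm x \<le> norm M * norm x"
      by (metis norm_matrix_vector_mult_le norm_minus_cancel)
    with assms \<open>x \<noteq> 0\<close> show False by simp
  qed
  then show ?thesis
    by (simp add: invertible_left_inverse matrix_left_invertible_ker)
qed

section \<open>Rank, kernels and factorizations\<close>

lemma rank_invertible_mult_left:
  fixes N :: "real^'m^'m" and Z :: "real^'n^'m"
  assumes "invertible N"
  shows "rank (N ** Z) = rank Z"
proof (rule antisym)
  obtain L where "L ** N = mat 1"
    using assms by (auto simp: invertible_left_inverse)
  then have "Z = L ** (N ** Z)"
    by (simp add: matrix_mul_assoc)
  then show "rank Z \<le> rank (N ** Z)"
    by (metis rank_mul_le_right)
qed (rule rank_mul_le_right)

lemma rank_invertible_mult_right:
  fixes N :: "real^'n^'n" and Z :: "real^'n^'m"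
  assumes "invertible N"
  shows "rank (Z ** N) = rank Z"
  by (metis assms matrix_transpose_mul rank_invertible_mult_left rank_transpose
      transpose_invertible)

text \<open>The kernel is the orthogonal complement of the row space. The formula serves to turn
  equality of ranks into equality of kernel dimensions.\<close>

lemma dim_null_space_plus_rank:
  fixes A :: "real^'n^'m"
  shows "dim {x. A *v x = 0} + rank A = CARD('n)"
proof -
  have "{x. A *v x = 0} = {y \<in> UNIV. \<forall>x\<in>span (rows A). orthogonal x y}" (is "_ = ?N")
  proof (intro set_eqI iffI; clarsimp)
    fix x y assume "A *v y = 0" "x \<in> span (rows A)"
    then show "orthogonal x y"
      using orthogonal_nullspace_rowspace orthogonal_commute by blast
  next
    fix y assume y: "\<forall>x\<in>span (rows A). orthogonal x y"
    have "A $ i \<bullet> y = 0" for i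
    proof -
      have "row i A \<in> span (rows A)"
        by (auto simp: rows_def intro: span_base)
      with y show ?thesis by (simp add: orthogonal_def row_def)
    qed
    then show "A *v y = 0"
      by (simp add: vec_eq_iff matrix_vector_mul_component)
  qed
  moreover have "dim ?N + dim (span (rows A)) = dim (UNIV :: (real^'n) set)"
    by (rule dim_subspace_orthogonal_to_vectors) auto
  ultimately show ?thesis
    by (simp add: row_rank_def)
qed

text \<open>\<open>G\<close> is a linear right inverse of \<open>Z\<close> on the range of
  \<open>Z\<close>. It makes \<open>mat 1 - G ** Z\<close> a projection onto the kernel of
  \<open>Z\<close>.\<close>

lemma generalized_inverse_exists:
  fixes Z :: "real^'n^'m"
  obtains G :: "real^'m^'n" where "Z ** G ** Z = Z"
proof -
  obtain g where g: "linear g" "\<And>v. v \<in> range ((*v) Z) \<Longrightarrow> Z *v g v = v"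
    using linear_exists_right_inverse_on[OF matrix_vector_mul_linear subspace_UNIV, of Z] by auto
  have "(Z ** matrix g ** Z) *v x = Z *v x" for x
    using g by (simp flip: matrix_vector_mul_assoc add: matrix_works)
  then show thesis
    using that matrix_eq by blast
qed

lemma rank_le_nnzc:
  fixes X :: "real^'d^'m"
  shows "rank X \<le> nnzc X"
proof -
  let ?C = "(\<lambda>i. column i X) ` {i. column i X \<noteq> 0}"
  have "columns X \<subseteq> span ?C"
  proof
    fix c assume "c \<in> columns X"
    then obtain i where "c = column i X"
      by (auto simp: columns_def)
    then show "c \<in> span ?C"
      by (cases "c = 0") (auto simp: span_zero intro: span_base)
  qed
  then have "dim (columns X) \<le> card ?C"
    by (intro dim_le_card) auto
  also have "\<dots> \<le> nnzc X"
    unfolding nnzc_def by (rule card_image_le) simp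
  finally show ?thesis
    by (simp add: column_rank_def)
qed

lemma rank_mult_transpose_le_nnzc:
  fixes X :: "real^'d^'m" and Y :: "real^'d^'n"
  shows "2 * rank (X ** transpose Y) \<le> nnzc X + nnzc Y"
proof -
  have "rank (X ** transpose Y) \<le> nnzc X"
    using rank_mul_le_left rank_le_nnzc by (rule le_trans)
  moreover have "rank (X ** transpose Y) \<le> nnzc Y"
    using rank_mul_le_right[of X "transpose Y"] rank_le_nnzc[of Y] by (simp add: rank_transpose)
  ultimately show ?thesis by simp
qed

text \<open>\<open>X ** transpose X\<close> is the orthogonal projection onto the range of
  \<open>Z\<close>, so it fixes \<open>Z\<close>. The column counts serve the local minimizers, the
  range inclusion the stationary points.\<close>

lemma orthonormal_factorization:
  fixes Z :: "real^'n^'m"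
  assumes "rank Z \<le> CARD('d::finite)"
  obtains X :: "real^'d^'m" where
    "X ** transpose (transpose Z ** X) = Z" "range ((*v) X) \<subseteq> range ((*v) Z)"
    "nnzc X \<le> rank Z" "nnzc (transpose Z ** X) \<le> rank Z"
proof -
  obtain B where B: "pairwise orthogonal B" "\<And>x. x \<in> B \<Longrightarrow> norm x = 1" "independent B"
    "card B = dim (range ((*v) Z))" "span B = range ((*v) Z)"
    using orthonormal_basis_subspace[of "range ((*v) Z)"]
    by (metis linear_subspace_image matrix_vector_mul_linear subspace_UNIV)
  have cardB: "card B = rank Z"
    using B by (simp add: rank_dim_range)
  have finB: "finite B"
    using B(3) by (rule finiteI_independent)
  \<comment> \<open>\<open>e\<close> gives each basis vector its own column position, possible since
    there are at most \<open>CARD('d)\<close> of them; all other columns of \<open>X\<close> are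
    zero.\<close>
  obtain e :: "real^'m \<Rightarrow> 'd" where inj: "inj_on e B"
    using assms cardB finB card_le_inj[of B "UNIV :: 'd set"] by auto
  define X :: "real^'d^'m" where
    "X = (\<chi> i k. if k \<in> e ` B then inv_into B e k $ i else 0)"
  have colX: "column k X = (if k \<in> e ` B then inv_into B e k else 0)" for k
    by (simp add: vec_eq_iff column_def X_def)
  have X_vec: "X *v x = (\<Sum>b\<in>B. (x $ e b) *\<^sub>R b)" for x
  proof -
    have "X *v x = (\<Sum>k\<in>UNIV. (x $ k) *\<^sub>R column k X)"
      by (simp add: matrix_mult_sum scalar_mult_eq_scaleR)
    also have "\<dots> = (\<Sum>k\<in>e ` B. (x $ k) *\<^sub>R column k X)"
      by (rule sum.mono_neutral_right) (auto simp: colX)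
    also have "\<dots> = (\<Sum>b\<in>B. (x $ e b) *\<^sub>R b)"
      by (simp add: sum.reindex[OF inj] colX inj)
    finally show ?thesis .
  qed
  \<comment> \<open>\<open>transpose X\<close> reads off the coordinates in the orthonormal basis
    \<open>B\<close>, and \<open>X\<close> reassembles the vector from them.\<close>
  have "(X ** transpose X) *v z = z" if "z \<in> span B" for z
  proof -
    have "(transpose X *v z) $ e b = z \<bullet> b" if "b \<in> B" for b
    proof -
      have "(transpose X *v z) $ e b = column (e b) X \<bullet> z"
        by (simp add: matrix_vector_mul_component column_def transpose_def)
      with that inj show ?thesis by (simp add: colX inner_commute)
    qed
    then have "(X ** transpose X) *v z = (\<Sum>b\<in>B. (z \<bullet> b) *\<^sub>R b)"
      by (simp add: X_vec flip: matrix_vector_mul_assoc)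
    also have "\<dots> = z"
      using B(1,2) that finB by (rule orthonormal_basis_expand)
    finally show ?thesis .
  qed
  then have "(X ** transpose X ** Z) *v x = Z *v x" for x
    using B(5) by (simp flip: matrix_vector_mul_assoc[of _ Z])
  then have fac: "X ** transpose X ** Z = Z"
    using matrix_eq by blast
  have "{k. column k X \<noteq> 0} \<subseteq> e ` B"
    by (auto simp: colX)
  then have nX: "nnzc X \<le> rank Z"
    unfolding nnzc_def using cardB
    by (metis card_image card_mono finB finite_imageI inj)
  show thesis
  proof
    show "X ** transpose (transpose Z ** X) = Z"
      using fac by (simp add: matrix_transpose_mul matrix_mul_assoc)
    show "range ((*v) X) \<subseteq> range ((*v) Z)"
      unfolding B(5)[symmetric] by (auto simp: X_vec intro!: span_sum span_scale intro: span_base)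
    show "nnzc X \<le> rank Z" by fact
    \<comment> \<open>A zero column of \<open>X\<close> stays zero under left
      multiplication.\<close>
    have "nnzc (transpose Z ** X) \<le> nnzc X"
      unfolding nnzc_def by (intro card_mono) (auto simp: column_matrix_mult)
    with nX show "nnzc (transpose Z ** X) \<le> rank Z" by simp
  qed
qed

subsection \<open>Normal cones\<close>

text \<open>The little-o condition in epsilon form, free of extended reals. The filter excludes
  \<open>y = x\<close>, so the norm can be multiplied out.\<close>

lemma regular_normal_cone_iff:
  "v \<in> regular_normal_cone C x \<longleftrightarrow>
     x \<in> C \<and> (\<forall>e>0. \<forall>\<^sub>F y in at x within C. v \<bullet> (y - x) \<le> e * norm (y - x))"
proof -
  have "(Limsup (at x within C) (\<lambda>y. ereal (v \<bullet> (y - x) / norm (y - x))) \<le> 0) \<longleftrightarrow>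
      (\<forall>e>0. \<forall>\<^sub>F y in at x within C. v \<bullet> (y - x) \<le> e * norm (y - x))" (is "?L \<longleftrightarrow> ?R")
  proof
    assume L: ?L
    show ?R
    proof (intro allI impI)
      fix e :: real assume "e > 0"
      with L have "\<forall>\<^sub>F y in at x within C. ereal (v \<bullet> (y - x) / norm (y - x)) < ereal e"
        unfolding Limsup_le_iff by (metis ereal_less(2))
      moreover have "\<forall>\<^sub>F y in at x within C. y \<noteq> x"
        by (simp add: eventually_at_filter)
      ultimately show "\<forall>\<^sub>F y in at x within C. v \<bullet> (y - x) \<le> e * norm (y - x)"
        by eventually_elim (simp add: pos_divide_less_eq)
    qed
  next
    assume R: ?R
    show ?L
    proof (rule ereal_le_epsilon2)
      fix e :: real assume "e > 0"
      with R have "\<forall>\<^sub>F y in at x within C. v \<bullet> (y - x) \<le> e * norm (y - x)"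
        by simp
      moreover have "\<forall>\<^sub>F y in at x within C. y \<noteq> x"
        by (simp add: eventually_at_filter)
      ultimately have "\<forall>\<^sub>F y in at x within C. ereal (v \<bullet> (y - x) / norm (y - x)) \<le> ereal e"
        by eventually_elim (simp add: pos_divide_le_eq)
      then show "Limsup (at x within C) (\<lambda>y. ereal (v \<bullet> (y - x) / norm (y - x))) \<le> 0 + ereal e"
        by (simp add: Limsup_bounded)
    qed
  qed
  then show ?thesis
    by (simp add: regular_normal_cone_def)
qed

lemma regular_normal_cone_subset_limiting: "regular_normal_cone C x \<subseteq> limiting_normal_cone C x"
proof
  fix v assume v: "v \<in> regular_normal_cone C x"
  then have "x \<in> C" by (simp add: regular_normal_cone_def)
  with v show "v \<in> limiting_normal_cone C x"
    unfolding limiting_normal_cone_def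
    by (intro CollectI conjI exI[of _ "\<lambda>_. x"] exI[of _ "\<lambda>_. v"]) simp_all
qed

lemma zero_in_limiting_normal_cone: "x \<in> C \<Longrightarrow> 0 \<in> limiting_normal_cone C x"
  using regular_normal_cone_subset_limiting[of C x] by (auto simp: regular_normal_cone_iff)

text \<open>Along the ray \<open>y = x + t *\<^sub>R w\<close> the factor \<open>t\<close> cancels
  from the epsilon inequality. This turns every feasible straight direction into a test of a normal
  vector.\<close>

lemma regular_normal_inner_nonpos:
  assumes v: "v \<in> regular_normal_cone C x"
    and C: "\<forall>\<^sub>F t in at_right 0. x + t *\<^sub>R w \<in> C"
  shows "v \<bullet> w \<le> 0"
proof (cases "w = 0")
  case False
  then have norm_w: "norm w > 0" by simp
  have *: "((\<lambda>t. x + t *\<^sub>R w) \<longlongrightarrow> x) (at_right 0)"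
    by (rule tendsto_eq_intros refl)+ simp
  have "filterlim (\<lambda>t. x + t *\<^sub>R w) (at x within C) (at_right 0)"
    unfolding filterlim_at
    using * C eventually_at_right_less[of "0::real"] False
    by (auto elim: eventually_elim2)
  then have ev: "\<forall>\<^sub>F t in at_right 0. v \<bullet> (t *\<^sub>R w) \<le> e * norm (t *\<^sub>R w)" if "e > 0" for e
    using v that unfolding regular_normal_cone_iff filterlim_iff by fastforce
  have "v \<bullet> w \<le> 0 + e" if "e > 0" for e
  proof -
    have "\<forall>\<^sub>F t in at_right (0::real). v \<bullet> w \<le> e"
      \<comment> \<open>The tolerance is taken as \<open>e / norm w\<close>, so that cancelling
        \<open>t\<close> leaves exactly \<open>e\<close>.\<close>
      using ev[OF divide_pos_pos[OF that norm_w]] eventually_at_right_less[of "0::real"]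
    proof eventually_elim
      case (elim t)
      with False show ?case by simp
    qed
    then show ?thesis by simp
  qed
  then show ?thesis
    by (rule field_le_epsilon)
qed simp

text \<open>At every point of a subspace both \<open>w\<close> and \<open>- w\<close> are feasible
  directions, and the resulting inequalities survive the limit.\<close>

lemma limiting_normal_subspace:
  assumes "subspace C" and v: "v \<in> limiting_normal_cone C x" and "w \<in> C"
  shows "v \<bullet> w = 0"
proof -
  from v obtain xs vs where xs: "\<And>k. xs k \<in> C"
    and vs: "\<And>k. vs k \<in> regular_normal_cone C (xs k)" and lim: "vs \<longlonglongrightarrow> v"
    by (auto simp: limiting_normal_cone_def)
  have "v \<bullet> u \<le> 0" if "u \<in> C" for u
  proof (rule LIMSEQ_le_const2)
    show "(\<lambda>k. vs k \<bullet> u) \<longlonglongrightarrow> v \<bullet> u"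
      by (intro tendsto_intros lim)
    have "vs k \<bullet> u \<le> 0" for k
      using assms(1) xs that
      by (intro regular_normal_inner_nonpos[OF vs] always_eventually allI)
        (simp add: subspace_add subspace_scale)
    then show "\<exists>N. \<forall>k\<ge>N. vs k \<bullet> u \<le> 0" by blast
  qed
  from this[of w] this[of "- w"] show ?thesis
    using assms by (simp add: subspace_neg)
qed

lemma subspace_restricted_cols: "subspace (restricted_cols I :: (real^'d^'p) set)"
  by (auto simp: subspace_def restricted_cols_def column_def vec_eq_iff)

lemma mult_in_restricted_cols:
  "X \<in> restricted_cols I \<Longrightarrow> M ** X \<in> restricted_cols I" for X :: "real^'d^'p"
  by (simp add: restricted_cols_def column_matrix_mult)

lemma in_restricted_cols_col_index: "X \<in> restricted_cols (col_index lam X)"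
  by (simp add: restricted_cols_def col_index_def)

section \<open>Normal vectors of the rank sets\<close>

lemma eventually_invertible_mat_1_plus:
  fixes A :: "real^'m^'m"
  shows "\<forall>\<^sub>F t in at_right 0. invertible (mat 1 + t *\<^sub>R A)"
proof -
  have "((\<lambda>t. norm (t *\<^sub>R A)) \<longlongrightarrow> 0) (at_right 0)"
    by (rule tendsto_eq_intros refl)+ simp
  then have "\<forall>\<^sub>F t in at_right 0. norm (t *\<^sub>R A) < 1"
    by (rule order_tendstoD) simp
  then show ?thesis
    by (rule eventually_mono) (rule invertible_mat_1_plus)
qed

text \<open>Invertible factors preserve the rank, hence membership in the set for every
  \<open>lam\<close>. The base matrix \<open>Z0\<close> is kept apart from \<open>Z\<close> because
  limiting normals are approached through other points of the same set.\<close>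

lemma regular_normal_rank_set:
  fixes Z v :: "real^'n^'m"
  assumes v: "v \<in> regular_normal_cone (rank_set d lam Z0) Z"
  shows "v ** transpose Z = 0" "transpose Z ** v = 0"
proof -
  have Z: "Z \<in> rank_set d lam Z0"
    using v by (simp add: regular_normal_cone_def)
  \<comment> \<open>With these choices, pairing \<open>v\<close> with \<open>?A ** Z\<close> gives
    the squared norm of \<open>?A\<close>, and pairing it with \<open>Z ** ?B\<close> gives that of
    \<open>?B\<close>.\<close>
  let ?A = "v ** transpose Z" and ?B = "transpose Z ** v"
  have "\<forall>\<^sub>F t in at_right 0. Z + t *\<^sub>R (?A ** Z) \<in> rank_set d lam Z0"
    using eventually_invertible_mat_1_plus[of ?A]
  proof eventually_elim
    case (elim t)
    then have "rank ((mat 1 + t *\<^sub>R ?A) ** Z) = rank Z"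
      by (rule rank_invertible_mult_left)
    with Z show ?case
      by (simp add: rank_set_def matrix_mult.add_left matrix_mult.scaleR_left)
  qed
  then have "v \<bullet> (?A ** Z) \<le> 0"
    by (rule regular_normal_inner_nonpos[OF v])
  then have "?A \<bullet> ?A \<le> 0"
    by (simp add: inner_matrix_mult_right[of ?A Z v] inner_commute[of v])
  then show "?A = 0" by (metis inner_eq_zero_iff inner_ge_zero order_antisym)
  have "\<forall>\<^sub>F t in at_right 0. Z + t *\<^sub>R (Z ** ?B) \<in> rank_set d lam Z0"
    using eventually_invertible_mat_1_plus[of ?B]
  proof eventually_elim
    case (elim t)
    then have "rank (Z ** (mat 1 + t *\<^sub>R ?B)) = rank Z"
      by (rule rank_invertible_mult_right)
    with Z show ?case
      by (simp add: rank_set_def matrix_mult.add_right matrix_mult.scaleR_right)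
  qed
  then have "v \<bullet> (Z ** ?B) \<le> 0"
    by (rule regular_normal_inner_nonpos[OF v])
  then have "?B \<bullet> ?B \<le> 0"
    by (simp add: inner_matrix_mult_left[of Z ?B v] inner_commute[of v])
  then show "?B = 0" by (metis inner_eq_zero_iff inner_ge_zero order_antisym)
qed

text \<open>Both equations are continuous jointly in the normal vector and the base point, so they
  pass to the limit.\<close>

lemma limiting_normal_rank_set:
  fixes Z v :: "real^'n^'m"
  assumes v: "v \<in> limiting_normal_cone (rank_set d lam Z0) Z"
  shows "v ** transpose Z = 0" "transpose Z ** v = 0"
proof -
  from v obtain xs vs where lim: "xs \<longlonglongrightarrow> Z" "vs \<longlonglongrightarrow> v"
    and vs: "\<And>k. vs k \<in> regular_normal_cone (rank_set d lam Z0) (xs k)"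
    by (auto simp: limiting_normal_cone_def)
  have "(\<lambda>k. vs k ** transpose (xs k)) \<longlonglongrightarrow> v ** transpose Z"
    "(\<lambda>k. transpose (xs k) ** vs k) \<longlonglongrightarrow> transpose Z ** v"
    by (intro matrix_mult.tendsto tendsto_transpose lim)+
  then show "v ** transpose Z = 0" "transpose Z ** v = 0"
    by (simp_all add: regular_normal_rank_set[OF vs] LIMSEQ_const_iff)
qed

text \<open>The columns of \<open>1 - GZ\<close> span the kernel of \<open>Z\<close>. The matrix \<open>1 + GE\<close> maps the kernel of
  \<open>Z + E\<close> injectively into that of \<open>Z\<close>, hence onto it by equality of ranks; \<open>W\<close> is the preimage
  of \<open>1 - GZ\<close>.\<close>

lemma rank_preserving_perturbation:
  fixes Z E :: "real^'n^'m" and G :: "real^'m^'n"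
  assumes G: "Z ** G ** Z = Z" and small: "norm (G ** E) \<le> 1/2"
    and rank: "rank (Z + E) = rank Z"
  obtains W where "W + G ** E ** W = mat 1 - G ** Z" "(Z + E) ** W = 0"
    "norm W \<le> 2 * norm (mat 1 - G ** Z)"
proof -
  let ?N = "mat 1 + G ** E" and ?P = "mat 1 - G ** Z"
  have inv: "invertible ?N"
    using small by (intro invertible_mat_1_plus) simp
  then obtain M where M: "?N ** M = mat 1" "M ** ?N = mat 1"
    by (auto simp: invertible_def)
  have ZP: "Z ** ?P = 0"
    using G by (simp add: matrix_mult.diff_right matrix_mul_assoc)
  let ?K' = "{x. (Z + E) *v x = 0}" and ?K = "{x. Z *v x = 0}"
  have "(*v) ?N ` ?K' \<subseteq> ?K"
  proof safe
    fix y assume "(Z + E) *v y = 0"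
    then have "E *v y = - (Z *v y)"
      by (simp add: matrix_vector_mult_add_rdistrib eq_neg_iff_add_eq_0 add.commute)
    \<comment> \<open>On the kernel of \<open>Z + E\<close>, the term \<open>G ** E\<close> acts as
      \<open>- (G ** Z)\<close>, which turns \<open>?N\<close> into \<open>?P\<close>.\<close>
    then have "?N *v y = ?P *v y"
      by (simp add: matrix_vector_mult_add_rdistrib matrix_vector_mult_diff_rdistrib
          flip: matrix_vector_mul_assoc) (simp add: linear_neg[OF matrix_vector_mul_linear])
    then show "Z *v (?N *v y) = 0"
      by (simp add: matrix_vector_mul_assoc ZP)
  qed
  moreover have "dim ((*v) ?N ` ?K') = dim ?K'"
  proof (rule dim_image_eq)
    have "inj ((*v) ?N)"
      using M(2) matrix_left_invertible_injective by blast
    then show "inj_on ((*v) ?N) (span ?K')"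
      by (rule inj_on_subset) simp
  qed simp
  moreover have "dim ?K' = dim ?K"
    using dim_null_space_plus_rank[of Z] dim_null_space_plus_rank[of "Z + E"] rank by simp
  moreover have "subspace ?K'" "subspace ?K"
    by (simp_all add: linear_subspace_kernel)
  ultimately have N_image: "(*v) ?N ` ?K' = ?K"
    by (intro subspace_dim_equal) (auto intro!: linear_subspace_image)
  define W where "W = M ** ?P"
  have NW: "?N ** W = ?P"
    using M by (simp add: W_def matrix_mul_assoc)
  then have W: "W + G ** E ** W = ?P"
    by (simp add: matrix_mult.add_left)
  moreover have "(Z + E) ** W = 0"
  proof -
    have "(Z + E) *v (W *v x) = 0" for x
    proof -
      have "?P *v x \<in> ?K"
        by (simp add: matrix_vector_mul_assoc ZP)
      then obtain y where y: "y \<in> ?K'" "?P *v x = ?N *v y"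
        using N_image by (metis (no_types, lifting) imageE)
      have "W *v x = M *v (?P *v x)"
        by (simp add: W_def matrix_vector_mul_assoc)
      also have "\<dots> = y"
        by (simp add: y(2) matrix_vector_mul_assoc M)
      finally show ?thesis using y by simp
    qed
    then show ?thesis
      by (simp add: matrix_eq flip: matrix_vector_mul_assoc)
  qed
  moreover have "norm W \<le> 2 * norm ?P"
  proof -
    have "norm W \<le> norm ?P + norm (G ** E ** W)"
      using norm_triangle_ineq4[of ?P "G ** E ** W"] by (simp flip: W)
    \<comment> \<open>Half of \<open>norm W\<close> is absorbed on the left, whence the factor
      2.\<close>
    also have "norm (G ** E ** W) \<le> 1/2 * norm W"
      using norm_matrix_mult_le mult_right_mono[OF small norm_ge_zero] by (rule order_trans)
    finally show ?thesis by simp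
  qed
  ultimately show thesis by (rule that)
qed

text \<open>Positivity of \<open>lam\<close> makes the rank constant on the set. Then
  \<open>Z' - Z\<close> is a sum of two terms orthogonal to \<open>v\<close> and a remainder
  quadratic in \<open>Z' - Z\<close>, which is eventually below
  \<open>e * norm (Z' - Z)\<close>.\<close>

lemma regular_normal_rank_setI:
  fixes Z v :: "real^'n^'m"
  assumes left: "v ** transpose Z = 0" and right: "transpose Z ** v = 0"
    and lam: "lam > 0" and d: "rank Z \<le> d"
  shows "v \<in> regular_normal_cone (rank_set d lam Z) Z"
proof -
  let ?C = "rank_set d lam Z"
  obtain G where G: "Z ** G ** Z = Z"
    by (rule generalized_inverse_exists)
  \<comment> \<open>\<open>K\<close> collects the factors of the remainder bound:
    \<open>norm v\<close>, \<open>norm G\<close> and the bound on \<open>norm W\<close>.\<close>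
  define K where "K = norm v * norm G * (2 * norm (mat 1 - G ** Z))"
  have bound: "v \<bullet> (Z' - Z) \<le> K * norm (Z' - Z) * norm (Z' - Z)"
    if "Z' \<in> ?C" and small: "norm (G ** (Z' - Z)) \<le> 1/2" for Z'
  proof -
    define E where "E = Z' - Z"
    have "rank (Z + E) = rank Z"
      using that lam by (simp add: E_def rank_set_def)
    with G small obtain W where W: "W + G ** E ** W = mat 1 - G ** Z" "(Z + E) ** W = 0"
      "norm W \<le> 2 * norm (mat 1 - G ** Z)"
      unfolding E_def[symmetric] by (rule rank_preserving_perturbation)
    have ZW: "E ** W = - (Z ** W)"
      using W(2) by (simp add: matrix_mult.add_left eq_neg_iff_add_eq_0 add.commute)
    \<comment> \<open>The first summand ends in \<open>Z\<close> and is killed by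
      \<open>left\<close>. Rewriting the second through \<open>W\<close> yields a term beginning
      with \<open>Z\<close>, killed by \<open>right\<close>, and the quadratic remainder.\<close>
    have "E = E ** G ** Z + E ** (mat 1 - G ** Z)"
      by (simp add: matrix_mult.diff_right matrix_mul_assoc)
    also have "E ** (mat 1 - G ** Z) = - (Z ** W) + E ** (G ** E ** W)"
      by (simp add: matrix_mult.add_right ZW flip: W(1))
    finally have "v \<bullet> E = v \<bullet> (E ** G ** Z + (- (Z ** W) + E ** (G ** E ** W)))"
      by simp
    also have "\<dots> = (E ** G ** Z) \<bullet> v - (Z ** W) \<bullet> v + v \<bullet> (E ** (G ** E ** W))"
      by (simp add: inner_add_right inner_diff_right inner_commute[of v])
    also have "(E ** G ** Z) \<bullet> v = 0"
      by (simp only: inner_matrix_mult_right left inner_zero_right)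
    also have "(Z ** W) \<bullet> v = 0"
      by (simp only: inner_matrix_mult_left right inner_zero_right)
    finally have "v \<bullet> E = v \<bullet> (E ** (G ** E ** W))" by simp
    also have "\<dots> \<le> norm v * norm (E ** (G ** E ** W))"
      by (rule norm_cauchy_schwarz)
    also have "\<dots> \<le> norm v * (norm E * (norm G * norm E * norm W))"
      by (intro mult_left_mono order_trans[OF norm_matrix_mult_le] mult_right_mono norm_ge_zero
          norm_matrix_mult_le)
    also have "\<dots> \<le> norm v * (norm E * (norm G * norm E * (2 * norm (mat 1 - G ** Z))))"
      by (intro mult_left_mono W mult_nonneg_nonneg norm_ge_zero)
    also have "\<dots> = K * norm E * norm E"
      by (simp add: K_def mult_ac)
    finally show ?thesis by (simp add: E_def)
  qed
  have lim: "((\<lambda>Z'. Z' - Z) \<longlongrightarrow> 0) (at Z within ?C)"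
    by (rule tendsto_eq_intros refl)+ simp
  have "\<forall>\<^sub>F Z' in at Z within ?C. v \<bullet> (Z' - Z) \<le> e * norm (Z' - Z)" if "e > 0" for e
  proof -
    have "((\<lambda>Z'. norm (G ** (Z' - Z))) \<longlongrightarrow> norm (G ** (0 :: real^'n^'m))) (at Z within ?C)"
      by (intro tendsto_norm matrix_mult.tendsto tendsto_const lim)
    then have "\<forall>\<^sub>F Z' in at Z within ?C. norm (G ** (Z' - Z)) < 1/2"
      by (rule order_tendstoD) simp
    moreover have "((\<lambda>Z'. K * norm (Z' - Z)) \<longlongrightarrow> K * norm (0::real^'n^'m)) (at Z within ?C)"
      by (intro tendsto_intros lim)
    then have "\<forall>\<^sub>F Z' in at Z within ?C. K * norm (Z' - Z) < e"
      by (rule order_tendstoD) (use that in simp)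
    moreover have "\<forall>\<^sub>F Z' in at Z within ?C. Z' \<in> ?C"
      by (simp add: eventually_at_filter)
    ultimately show ?thesis
    proof eventually_elim
      case (elim Z')
      then have "v \<bullet> (Z' - Z) \<le> K * norm (Z' - Z) * norm (Z' - Z)"
        by (intro bound) simp_all
      also have "\<dots> \<le> e * norm (Z' - Z)"
        using elim by (intro mult_right_mono) simp_all
      finally show ?case .
    qed
  qed
  with d show ?thesis
    by (simp add: regular_normal_cone_iff rank_set_def)
qed

subsection \<open>Local minimizers and stationary points\<close>

lemma zero_in_translate_iff: "0 \<in> a +o N \<longleftrightarrow> - a \<in> N" for a :: "'a::ab_group_add"
  by (auto simp: elt_set_plus_def eq_neg_iff_add_eq_0 add.commute intro: bexI[of _ "- a"]
      dest: minus_unique)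

lemma local_minimizers_subset:
  fixes f :: "(real^'n^'m) \<times> (real^'n^'m) \<Rightarrow> real"
  assumes lam: "lam \<ge> 0"
  shows "local_minimizers (objective_L f lam beta) (feasible_L CARD('d::finite) \<kappa>1 \<kappa>2)
    \<subseteq> factor_image (local_minimizers (objective_F f lam beta)
        (feasible_F \<kappa>1 \<kappa>2 :: ((real^'d^'m) \<times> (real^'d^'n) \<times> (real^'n^'m)) set))"
proof safe
  fix Z S
  let ?L = "objective_L f lam beta"
    and ?CL = "feasible_L CARD('d) \<kappa>1 \<kappa>2 :: ((real^'n^'m) \<times> (real^'n^'m)) set"
  let ?F = "objective_F f lam beta"
    and ?CF = "feasible_F \<kappa>1 \<kappa>2 :: ((real^'d^'m) \<times> (real^'d^'n) \<times> (real^'n^'m)) set"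
  let ?g = "\<lambda>(X :: real^'d^'m, Y :: real^'d^'n, S :: real^'n^'m). (X ** transpose Y, S)"
  assume "(Z, S) \<in> local_minimizers ?L ?CL"
  then obtain e where feas: "(Z, S) \<in> ?CL" and "e > 0"
    and min: "\<And>y. y \<in> ?CL \<Longrightarrow> y \<in> ball (Z, S) e \<Longrightarrow> ?L (Z, S) \<le> ?L y"
    by (auto simp: local_minimizers_def)
  from feas have "rank Z \<le> CARD('d)" and S: "S \<in> entry_box \<kappa>1 \<kappa>2"
    by (simp_all add: feasible_L_def)
  then obtain X :: "real^'d^'m" where X: "X ** transpose (transpose Z ** X) = Z"
    "nnzc X \<le> rank Z" "nnzc (transpose Z ** X) \<le> rank Z"
    by (metis orthonormal_factorization)
  define Y where "Y = transpose Z ** X"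
  have XY: "X ** transpose Y = Z" "nnzc X \<le> rank Z" "nnzc Y \<le> rank Z"
    using X by (simp_all add: Y_def)
  have value_le: "?L (?g w) \<le> ?F w" for w
  proof -
    obtain X' Y' S' where w: "w = (X', Y', S')" by (cases w)
    have "2 * real (rank (X' ** transpose Y')) \<le> real (nnzc X') + real (nnzc Y')"
      using rank_mult_transpose_le_nnzc[of X' Y'] by linarith
    then show ?thesis
      using mult_left_mono[OF _ lam] by (fastforce simp: w objective_L_def objective_F_def)
  qed
  have value_ge: "?F (X, Y, S) \<le> ?L (Z, S)"
  proof -
    have "real (nnzc X) + real (nnzc Y) \<le> 2 * real (rank Z)"
      using XY by linarith
    then show ?thesis
      using mult_left_mono[OF _ lam] by (fastforce simp: XY(1) objective_L_def objective_F_def)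
  qed
  have feas': "?g w \<in> ?CL" if "w \<in> ?CF" for w
  proof -
    obtain X' Y' S' where w: "w = (X', Y', S')" by (cases w)
    have "rank (X' ** transpose Y') \<le> CARD('d)"
      using rank_mul_le_left[of X' "transpose Y'"] rank_bound[of X'] by simp
    with that show ?thesis by (simp add: w feasible_L_def feasible_F_def)
  qed
  have "isCont ?g (X, Y, S)"
    unfolding isCont_def case_prod_beta
    by (intro tendsto_Pair matrix_mult.tendsto tendsto_transpose tendsto_fst tendsto_snd
        tendsto_ident_at)
  \<comment> \<open>Continuity of the product map gives a radius whose ball lands where
    \<open>(Z, S)\<close> is minimal.\<close>
  then obtain r where "r > 0" and r: "\<And>w. w \<in> ball (X, Y, S) r \<Longrightarrow> ?g w \<in> ball (Z, S) e"
    using \<open>e > 0\<close> unfolding continuous_at_ball by (metis (mono_tags, lifting) XY(1) case_prod_conv image_subset_iff)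
  have "(X, Y, S) \<in> local_minimizers ?F ?CF"
    unfolding local_minimizers_def
  proof (intro CollectI conjI exI ballI)
    show "(X, Y, S) \<in> ?CF" using S by (simp add: feasible_F_def)
    show "r > 0" by fact
    fix w assume w: "w \<in> ?CF \<inter> ball (X, Y, S) r"
    \<comment> \<open>The chain starts at the cheap factorization of \<open>Z\<close>, passes
      through local minimality for (L), and returns to (F) by the rank bound on arbitrary
      factors.\<close>
    note value_ge
    also have "?L (Z, S) \<le> ?L (?g w)"
      using w by (intro min feas' r) simp_all
    also note value_le
    finally show "?F (X, Y, S) \<le> ?F w" .
  qed
  with XY(1) show "(Z, S) \<in> factor_image (local_minimizers ?F ?CF)"
    unfolding factor_image_def by blast
qed

text \<open>The same subgradient serves both systems. \<open>HZ ** Y\<close> contains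
  \<open>HZ ** transpose Z\<close>, and \<open>transpose HZ\<close> annihilates the range of
  \<open>Z\<close>, which contains that of \<open>X\<close>; so both products vanish, and zero is
  always normal.\<close>

lemma stationary_L_subset:
  fixes f :: "(real^'n^'m) \<times> (real^'n^'m) \<Rightarrow> real"
  shows "stationary_L f lam beta CARD('d::finite) \<kappa>1 \<kappa>2
    \<subseteq> factor_image (stationary_F f lam beta \<kappa>1 \<kappa>2 ::
        ((real^'d^'m) \<times> (real^'d^'n) \<times> (real^'n^'m)) set)"
proof safe
  fix Z S
  assume "(Z, S) \<in> stationary_L f lam beta CARD('d) \<kappa>1 \<kappa>2"
  then obtain HZ HS where rank: "rank Z \<le> CARD('d)" and S: "S \<in> entry_box \<kappa>1 \<kappa>2"
    and H: "(HZ, HS) \<in> limiting_subdifferential f (Z, S)"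
    and HZ: "- HZ \<in> limiting_normal_cone (rank_set CARD('d) lam Z) Z"
    and HS: "- HS \<in> limiting_normal_cone (restricted_box \<kappa>1 \<kappa>2 (entry_index beta S)) S"
    by (auto simp: stationary_L_def feasible_L_def)
  from limiting_normal_rank_set[OF HZ] have HZ0: "HZ ** transpose Z = 0" "transpose Z ** HZ = 0"
    by (simp_all add: matrix_mult.minus_left matrix_mult.minus_right)
  from rank obtain X :: "real^'d^'m" where X: "X ** transpose (transpose Z ** X) = Z"
    "range ((*v) X) \<subseteq> range ((*v) Z)"
    by (metis orthonormal_factorization)
  define Y where "Y = transpose Z ** X"
  have XY: "X ** transpose Y = Z" using X by (simp add: Y_def)
  have "HZ ** Y = 0"
    by (simp add: Y_def matrix_mul_assoc HZ0)
  moreover have "transpose HZ ** X = 0"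
  proof -
    have Z0: "transpose HZ ** Z = 0"
      using arg_cong[OF HZ0(2), of transpose] by (simp add: matrix_transpose_mul transpose_zero)
    have "transpose HZ *v (X *v x) = 0" for x
    proof -
      obtain y where "X *v x = Z *v y" using X(2) by blast
      then show ?thesis by (simp add: matrix_vector_mul_assoc Z0)
    qed
    then show ?thesis
      by (simp add: matrix_eq flip: matrix_vector_mul_assoc)
  qed
  ultimately have "(X, Y, S) \<in> stationary_F f lam beta \<kappa>1 \<kappa>2"
    using S H HS unfolding stationary_F_def
    by (simp add: feasible_F_def XY zero_in_translate_iff zero_in_limiting_normal_cone
        in_restricted_cols_col_index) (rule exI[of _ HZ], rule exI[of _ HS],
        simp add: zero_in_limiting_normal_cone in_restricted_cols_col_index)
  with XY show "(Z, S) \<in> factor_image (stationary_F f lam beta \<kappa>1 \<kappa>2 ::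
        ((real^'d^'m) \<times> (real^'d^'n) \<times> (real^'n^'m)) set)"
    unfolding factor_image_def by blast
qed

text \<open>The columns of \<open>X\<close> lie in the subspace that defines the normal cone at \<open>X\<close>, so testing
  a normal vector against the matrices \<open>M ** X\<close> suffices.\<close>

lemma normal_restricted_cols_mult_transpose:
  fixes X :: "real^'d^'p"
  assumes "- V \<in> limiting_normal_cone (restricted_cols (col_index lam X)) X"
  shows "V ** transpose X = 0"
proof -
  \<comment> \<open>Taking \<open>M\<close> as \<open>V ** transpose X\<close> makes the pairing a
    squared norm up to sign.\<close>
  have "- V \<bullet> ((V ** transpose X) ** X) = 0"
    by (rule limiting_normal_subspace[OF subspace_restricted_cols assms])
      (intro mult_in_restricted_cols in_restricted_cols_col_index)
  then have "(V ** transpose X) \<bullet> (V ** transpose X) = 0"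
    by (simp add: inner_matrix_mult_right[of _ X V] inner_commute[of V])
  then show ?thesis by simp
qed

text \<open>Multiplying \<open>HZ ** Y\<close> by \<open>transpose X\<close> and
  \<open>transpose HZ ** X\<close> by \<open>transpose Y\<close> leaves equations in
  \<open>Z\<close> alone. For \<open>lam > 0\<close> these make \<open>- HZ\<close> even a regular
  normal of the rank set.\<close>

lemma stationary_F_subset:
  fixes f :: "(real^'n^'m) \<times> (real^'n^'m) \<Rightarrow> real"
  assumes lam: "lam > 0"
  shows "factor_image (stationary_F f lam beta \<kappa>1 \<kappa>2 ::
        ((real^'d^'m) \<times> (real^'d^'n) \<times> (real^'n^'m)) set)
    \<subseteq> stationary_L f lam beta CARD('d::finite) \<kappa>1 \<kappa>2"
proof
  fix w
  assume "w \<in> factor_image (stationary_F f lam beta \<kappa>1 \<kappa>2 ::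
        ((real^'d^'m) \<times> (real^'d^'n) \<times> (real^'n^'m)) set)"
  then obtain X :: "real^'d^'m" and Y :: "real^'d^'n" and S HZ HS
    where w: "w = (X ** transpose Y, S)" and S: "S \<in> entry_box \<kappa>1 \<kappa>2"
    and H: "(HZ, HS) \<in> limiting_subdifferential f (X ** transpose Y, S)"
    and HX: "- (HZ ** Y) \<in> limiting_normal_cone (restricted_cols (col_index lam X)) X"
    and HY: "- (transpose HZ ** X) \<in> limiting_normal_cone (restricted_cols (col_index lam Y)) Y"
    and HS: "- HS \<in> limiting_normal_cone (restricted_box \<kappa>1 \<kappa>2 (entry_index beta S)) S"
    by (auto simp: factor_image_def stationary_F_def feasible_F_def zero_in_translate_iff)
  define Z where "Z = X ** transpose Y"
  have rank: "rank Z \<le> CARD('d)"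
    using rank_mul_le_left[of X "transpose Y"] rank_bound[of X] by (simp add: Z_def)
  have "HZ ** transpose Z = 0"
    using normal_restricted_cols_mult_transpose[OF HX]
    by (simp add: Z_def matrix_transpose_mul matrix_mul_assoc)
  moreover have "transpose Z ** HZ = 0"
    using arg_cong[OF normal_restricted_cols_mult_transpose[OF HY], of transpose]
    by (simp add: Z_def matrix_transpose_mul matrix_mul_assoc transpose_zero)
  ultimately have "- HZ \<in> regular_normal_cone (rank_set CARD('d) lam Z) Z"
    using lam rank
    by (intro regular_normal_rank_setI) (simp_all add: matrix_mult.minus_left matrix_mult.minus_right)
  then have "- HZ \<in> limiting_normal_cone (rank_set CARD('d) lam Z) Z"
    using regular_normal_cone_subset_limiting by blast
  with rank S H HS show "w \<in> stationary_L f lam beta CARD('d) \<kappa>1 \<kappa>2"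
    by (auto simp: w stationary_L_def feasible_L_def Z_def)
qed

theorem theorem1:
  fixes f :: "(real^'n^'m) \<times> (real^'n^'m) \<Rightarrow> real"
    and lam beta :: real
    and \<kappa>1 \<kappa>2 :: "ereal^'n^'m"
  assumes "lam \<ge> 0" and "beta \<ge> 0"
    and "\<forall>w. f w \<ge> 0" and "locally_lipschitz f"
    and "\<forall>i j. \<kappa>1 $ i $ j \<le> 0" and "\<forall>i j. 0 \<le> \<kappa>2 $ i $ j"
  shows "local_minimizers (objective_L f lam beta) (feasible_L CARD('d::finite) \<kappa>1 \<kappa>2)
           \<subseteq> factor_image (local_minimizers (objective_F f lam beta)
                (feasible_F \<kappa>1 \<kappa>2 :: ((real^'d^'m) \<times> (real^'d^'n) \<times> (real^'n^'m)) set)) \<and>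
         stationary_L f lam beta CARD('d) \<kappa>1 \<kappa>2
           \<subseteq> factor_image (stationary_F f lam beta \<kappa>1 \<kappa>2 ::
                ((real^'d^'m) \<times> (real^'d^'n) \<times> (real^'n^'m)) set) \<and>
         (lam > 0 \<longrightarrow>
           stationary_L f lam beta CARD('d) \<kappa>1 \<kappa>2
             = factor_image (stationary_F f lam beta \<kappa>1 \<kappa>2 ::
                ((real^'d^'m) \<times> (real^'d^'n) \<times> (real^'n^'m)) set))"
  using local_minimizers_subset[OF assms(1)] stationary_L_subset stationary_F_subset
  by (metis subset_antisym)

end
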